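(* There is an absolute constant $c>0$ such that for every real $\Lambda\ge 2$ and every integer $N\ge 1$ there exists a (finite) collection $\mathcal{E}$ of subsets of $\mathbb{R}$ with $\|\mathcal{E}\|_{\mathrm{Carleson}}\le\Lambda$ such that for any partition $$\mathcal{E}=\mathcal{E}_1\cup\dots\cup\mathcal{E}_N$$ there exists at least one $i\in\{1,\dots,N\}$ for which $\|\mathcal{E}_i\|_{\mathrm{Carleson}}\ge c\,\Lambda$.
   Context: A collection is a finite unordered sequence of (Lebesgue measurable, finite measure) sets; repeated elements are allowed, and sums over a collection count multiplicity. For a collection $\mathcal{F}$ let $\mathrm{sh}(\mathcal{F})=\bigcup_{R\in\mathcal{F}}R$. With $|\cdot|$ denoting Lebesgue measure and the convention $\frac00=0$, $$\|\mathcal{E}\|_{\mathrm{Carleson}}=\sup\Bigl\{\frac{1}{|\mathrm{sh}(\mathcal{F})|}\sum_{R\in\mathcal{F}}|R|:\ \mathcal{F}\subseteq\mathcal{E}\Bigr\}.$$ *)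

theory Defs
  imports "HOL-Analysis.Analysis" "HOL-Library.Multiset"
begin

text \<open>Finite unordered sequences with repetition are multisets.\<close>

definition collection :: "real set multiset \<Rightarrow> bool" where
  "collection E \<longleftrightarrow> (\<forall>R \<in># E. R \<in> lmeasurable)"

definition sh :: "real set multiset \<Rightarrow> real set" where
  "sh F = \<Union> (set_mset F)"

text \<open>
  If \<open>sh F\<close> is a null set, then every member of a collection \<open>F\<close> is null, so the only
  quotient with denominator 0 is \<open>0 / 0\<close>, which is 0 in HOL.  The supremum ranges over the
  finitely many sub-multisets of \<open>E\<close> (including the empty one, with quotient 0), so
  it is an honest supremum in the reals.
\<close>

definition carleson_norm :: "real set multiset \<Rightarrow> real" where
  "carleson_norm E =
     (SUP F \<in> {F. F \<subseteq># E}. (\<Sum>R\<in>#F. measure lebesgue R) / measure lebesgue (sh F))"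

end

theory Submission
  imports Defs
begin

text \<open>
  All sets share the block \<open>[0, 1)\<close>, and each of them has in addition a private block of length
  \<open>\<epsilon> = 1 / (\<Lambda> - 1)\<close>.  Any \<open>k \<ge> 1\<close> of these sets have the Carleson quotient
  \<open>k (1 + \<epsilon>) / (1 + k \<epsilon>)\<close>, which is at most \<open>(1 + \<epsilon>) / \<epsilon> = \<Lambda>\<close>, and at least \<open>\<Lambda> / 2\<close> as soon
  as \<open>k \<epsilon> \<ge> 1\<close>.  Since the number of sets is free, the pigeonhole principle provides a
  class of any partition into \<open>N\<close> classes with that many members.
\<close>

definition sunflower_set :: "real \<Rightarrow> nat \<Rightarrow> real set" where
  "sunflower_set \<epsilon> j = {0..<1} \<union> {real j + 2..<real j + 2 + \<epsilon>}"

text \<open>The image is a set, so every multiplicity is at most one; \<open>n\<close> counts the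
  indices, and it is the number of members once \<open>sunflower_set \<epsilon>\<close> is
  injective.\<close>

definition sunflower :: "real \<Rightarrow> nat \<Rightarrow> real set multiset" where
  "sunflower \<epsilon> n = mset_set (sunflower_set \<epsilon> ` {..<n})"

lemma lmeasurable_atLeastLessThan: "{a..<b::real} \<in> lmeasurable"
  by (rule bounded_set_imp_lmeasurable) auto

lemma sunflower_set_lmeasurable: "sunflower_set \<epsilon> j \<in> lmeasurable"
  unfolding sunflower_set_def by (intro fmeasurable.Un lmeasurable_atLeastLessThan)

text \<open>The left endpoint of a private block lies in no other set of the family;
  \<open>0 < \<epsilon>\<close> makes it a point of its own set.\<close>

lemma inj_sunflower_set:
  fixes \<epsilon> :: real
  assumes "0 < \<epsilon>" "\<epsilon> \<le> 1"
  shows "inj (sunflower_set \<epsilon>)"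
proof (rule injI)
  fix i j :: nat
  assume "sunflower_set \<epsilon> i = sunflower_set \<epsilon> j"
  moreover have "real i + 2 \<in> sunflower_set \<epsilon> i" "real j + 2 \<in> sunflower_set \<epsilon> j"
    using assms by (auto simp: sunflower_set_def)
  ultimately have "real i + 2 \<in> sunflower_set \<epsilon> j" "real j + 2 \<in> sunflower_set \<epsilon> i"
    by auto
  then show "i = j"
    using assms by (auto simp: sunflower_set_def)
qed

text \<open>The private blocks start at distinct integers and have length at most 1. Being
  half-open, they stay disjoint even for \<open>\<epsilon> = 1\<close>.\<close>

lemma measure_sunflower_petals:
  fixes \<epsilon> :: real
  assumes "0 \<le> \<epsilon>" "\<epsilon> \<le> 1" "finite J"
  shows "measure lebesgue (\<Union>j\<in>J. {real j + 2..<real j + 2 + \<epsilon>}) = card J * \<epsilon>"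
proof -
  have "disjoint_family_on (\<lambda>j. {real j + 2..<real j + 2 + \<epsilon>}) J"
    unfolding disjoint_family_on_def
  proof (intro ballI impI)
    fix i j :: nat
    assume "i \<noteq> j"
    then consider "real i + 1 \<le> real j" | "real j + 1 \<le> real i"
      by linarith
    then show "{real i + 2..<real i + 2 + \<epsilon>} \<inter> {real j + 2..<real j + 2 + \<epsilon>} = {}"
      using assms by cases auto
  qed
  then show ?thesis
    using assms by (subst measure_finite_Union) auto
qed

lemma measure_sunflower_set:
  fixes \<epsilon> :: real
  assumes "0 \<le> \<epsilon>" "\<epsilon> \<le> 1"
  shows "measure lebesgue (sunflower_set \<epsilon> j) = 1 + \<epsilon>"
  unfolding sunflower_set_def using assms by (subst measure_Un3) (auto simp: lmeasurable_atLeastLessThan)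

lemma measure_UN_sunflower_set:
  fixes \<epsilon> :: real
  assumes "0 \<le> \<epsilon>" "\<epsilon> \<le> 1" "finite J" "J \<noteq> {}"
  shows "measure lebesgue (\<Union>j\<in>J. sunflower_set \<epsilon> j) = 1 + card J * \<epsilon>"
proof -
  let ?P = "\<Union>j\<in>J. {real j + 2..<real j + 2 + \<epsilon>}"
  have "(\<Union>j\<in>J. sunflower_set \<epsilon> j) = {0..<1} \<union> ?P"
    using assms by (auto simp: sunflower_set_def)
  moreover have "measure lebesgue ({0..<1} \<union> ?P) = measure lebesgue {0..<1::real} + measure lebesgue ?P - measure lebesgue ({0..<1} \<inter> ?P)"
    using assms by (intro measure_Un3 fmeasurable.finite_UN lmeasurable_atLeastLessThan) auto
  \<comment> \<open>The shift by 2 keeps all private blocks to the right of the common one.\<close>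
  moreover have "{0..<1} \<inter> ?P = {}"
    by auto
  ultimately show ?thesis
    using measure_sunflower_petals[OF assms(1-3)] by simp
qed

lemma carleson_quotient_sunflower:
  fixes \<epsilon> :: real
  assumes \<epsilon>: "0 \<le> \<epsilon>" "\<epsilon> \<le> 1" and F: "F \<subseteq># sunflower \<epsilon> n" "F \<noteq> {#}"
  shows "(\<Sum>R\<in>#F. measure lebesgue R) / measure lebesgue (sh F) =
    size F * (1 + \<epsilon>) / (1 + size F * \<epsilon>)"
proof -
  have sub: "set_mset F \<subseteq> sunflower_set \<epsilon> ` {..<n}"
    using set_mset_mono[OF F(1)] by (simp add: sunflower_def)
  \<comment> \<open>Taking \<open>J\<close> with the map injective on it makes \<open>card J\<close>
    the number of distinct sets even for \<open>\<epsilon> = 0\<close>, where all of them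
    coincide.\<close>
  then obtain J where J: "J \<subseteq> {..<n}" "inj_on (sunflower_set \<epsilon>) J" "set_mset F = sunflower_set \<epsilon> ` J"
    by (auto simp: subset_image_inj)
  have fin: "finite J"
    using J(1) finite_subset by blast
  \<comment> \<open>A sub-multiset of a multiset without repetitions has none, so its size is the
    number of its distinct members.\<close>
  have "F = mset_set (set_mset F)"
  proof (rule multiset_eqI)
    fix R
    have "count F R \<le> count (sunflower \<epsilon> n) R"
      using F(1) by (rule mset_subset_eq_count)
    also have "\<dots> \<le> 1"
      by (simp add: sunflower_def count_mset_set')
    finally show "count F R = count (mset_set (set_mset F)) R"
      by (cases "R \<in># F") (simp_all add: le_antisym count_eq_zero_iff)
  qed
  then have "size F = card (set_mset F)"
    by (metis size_mset_set)
  then have "size F = card J"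
    using J(2,3) by (simp add: card_image)
  moreover have "(\<Sum>R\<in>#F. measure lebesgue R) = size F * (1 + \<epsilon>)"
  proof -
    have "image_mset (measure lebesgue) F = image_mset (\<lambda>_. 1 + \<epsilon>) F"
      using sub measure_sunflower_set[OF \<epsilon>] by (intro image_mset_cong) auto
    then show ?thesis
      by simp
  qed
  moreover have "measure lebesgue (sh F) = 1 + card J * \<epsilon>"
    using measure_UN_sunflower_set[OF \<epsilon> fin] F(2) J(3) by (auto simp: sh_def)
  ultimately show ?thesis
    by simp
qed

lemma carleson_quotient_sunflower_le:
  fixes \<epsilon> :: real
  assumes \<epsilon>: "0 < \<epsilon>" "\<epsilon> \<le> 1" and F: "F \<subseteq># sunflower \<epsilon> n"
  shows "(\<Sum>R\<in>#F. measure lebesgue R) / measure lebesgue (sh F) \<le> (1 + \<epsilon>) / \<epsilon>"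
proof (cases "F = {#}")
  case False
  have "0 < 1 + size F * \<epsilon>"
    using \<epsilon> by (simp add: add_pos_nonneg)
  \<comment> \<open>After clearing denominators this is
    \<open>size F * \<epsilon> \<le> 1 + size F * \<epsilon>\<close>, times
    \<open>1 + \<epsilon>\<close>.\<close>
  then have "size F * (1 + \<epsilon>) / (1 + size F * \<epsilon>) \<le> (1 + \<epsilon>) / \<epsilon>"
    using \<epsilon> by (intro mult_imp_div_pos_le) (auto simp: field_simps)
  then show ?thesis
    using carleson_quotient_sunflower[of \<epsilon> F n] \<epsilon> F False by simp
qed (use \<epsilon> in simp)

lemma carleson_norm_sunflower_le:
  fixes \<epsilon> :: real
  assumes "0 < \<epsilon>" "\<epsilon> \<le> 1"
  shows "carleson_norm (sunflower \<epsilon> n) \<le> (1 + \<epsilon>) / \<epsilon>"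
  unfolding carleson_norm_def
  using carleson_quotient_sunflower_le[OF assms] by (intro cSUP_least) auto

lemma carleson_norm_ge_half:
  fixes \<epsilon> :: real
  assumes \<epsilon>: "0 < \<epsilon>" "\<epsilon> \<le> 1" and F: "F \<subseteq># sunflower \<epsilon> n" and large: "1 \<le> size F * \<epsilon>"
  shows "(1 + \<epsilon>) / (2 * \<epsilon>) \<le> carleson_norm F"
proof -
  have "0 < 1 + size F * \<epsilon>"
    using large by linarith
  \<comment> \<open>From \<open>large\<close>, the denominator
    \<open>1 + size F * \<epsilon>\<close> is at most
    \<open>2 * (size F * \<epsilon>)\<close>.\<close>
  then have "(1 + \<epsilon>) / (2 * \<epsilon>) \<le> size F * (1 + \<epsilon>) / (1 + size F * \<epsilon>)"
    using \<epsilon> mult_right_mono[OF large, of "1 + \<epsilon>"]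
    by (intro mult_imp_le_div_pos) (auto simp: field_simps)
  also have "\<dots> = (\<Sum>R\<in>#F. measure lebesgue R) / measure lebesgue (sh F)"
    using carleson_quotient_sunflower[of \<epsilon> F n] \<epsilon> F large by fastforce
  \<comment> \<open>\<open>F\<close> competes in its own supremum. The quotients are bounded because
    each sub-multiset of \<open>F\<close> is also one of the sunflower.\<close>
  also have "\<dots> \<le> carleson_norm F"
    unfolding carleson_norm_def
  proof (rule cSUP_upper)
    show "bdd_above ((\<lambda>G. (\<Sum>R\<in>#G. measure lebesgue R) / measure lebesgue (sh G)) ` {G. G \<subseteq># F})"
      using carleson_quotient_sunflower_le[OF \<epsilon>] F subset_mset.order_trans
      by (intro bdd_aboveI2[where M = "(1 + \<epsilon>) / \<epsilon>"]) blast
  qed simp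
  finally show ?thesis .
qed

theorem theoremB:
  "\<exists>c::real. c > 0 \<and>
     (\<forall>(\<Lambda>::real) (N::nat). \<Lambda> \<ge> 2 \<longrightarrow> N \<ge> 1 \<longrightarrow>
        (\<exists>E :: real set multiset. collection E \<and> carleson_norm E \<le> \<Lambda> \<and>
           (\<forall>P :: nat \<Rightarrow> real set multiset. E = (\<Sum>i\<in>{1..N}. P i) \<longrightarrow>
              (\<exists>i\<in>{1..N}. carleson_norm (P i) \<ge> c * \<Lambda>))))"
proof (intro exI[where x = "1/2"] conjI allI impI)
  fix \<Lambda> :: real and N :: nat
  assume \<Lambda>: "\<Lambda> \<ge> 2" and N: "N \<ge> 1"
  \<comment> \<open>This solves \<open>(1 + \<epsilon>) / \<epsilon> = \<Lambda>\<close>; the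
    hypothesis \<open>\<Lambda> \<ge> 2\<close> gives \<open>\<epsilon> \<le> 1\<close>.\<close>
  define \<epsilon> where "\<epsilon> = 1 / (\<Lambda> - 1)"
  have \<epsilon>: "0 < \<epsilon>" "\<epsilon> \<le> 1"
    using \<Lambda> by (auto simp: \<epsilon>_def)
  have \<Lambda>_eq: "(1 + \<epsilon>) / \<epsilon> = \<Lambda>"
    using \<Lambda> by (simp add: \<epsilon>_def field_simps)
  \<comment> \<open>Since \<open>\<Lambda> - 1\<close> equals \<open>1 / \<epsilon>\<close>, any
    \<open>K\<close> sets have private blocks of total length at least that of the common
    block.\<close>
  obtain K :: nat where "\<Lambda> - 1 \<le> K"
    using real_arch_simple by blast
  then have K: "1 \<le> K * \<epsilon>"
    using \<Lambda> by (simp add: \<epsilon>_def field_simps)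
  let ?E = "sunflower \<epsilon> (N * K)"
  have "\<exists>i\<in>{1..N}. 1 / 2 * \<Lambda> \<le> carleson_norm (P i)" if P: "?E = (\<Sum>i\<in>{1..N}. P i)" for P
  proof -
    have "size ?E = N * K"
      using inj_sunflower_set[OF \<epsilon>] by (simp add: sunflower_def card_image inj_on_subset)
    then have total: "(\<Sum>i\<in>{1..N}. size (P i)) = N * K"
      by (simp add: P)
    have "\<exists>i\<in>{1..N}. K \<le> size (P i)"
    \<comment> \<open>If every class had fewer than \<open>K\<close> members, the total would be
      below \<open>N * K\<close>; strictness uses that \<open>{1..N}\<close> is nonempty.\<close>
    proof (rule ccontr)
      assume "\<not> ?thesis"
      then have "(\<Sum>i\<in>{1..N}. size (P i)) < (\<Sum>i\<in>{1..N}. K)"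
        using N by (intro sum_strict_mono) (auto simp: not_le)
      with total show False
        by simp
    qed
    then obtain i where i: "i \<in> {1..N}" "K \<le> size (P i)"
      by blast
    have "P i \<subseteq># ?E"
      unfolding P using i(1) by (simp add: sum.remove)
    moreover have "1 \<le> size (P i) * \<epsilon>"
      using K mult_right_mono[of "real K" "real (size (P i))" \<epsilon>] i(2) \<epsilon> by linarith
    ultimately have "(1 + \<epsilon>) / (2 * \<epsilon>) \<le> carleson_norm (P i)"
      by (rule carleson_norm_ge_half[OF \<epsilon>])
    moreover have "(1 + \<epsilon>) / (2 * \<epsilon>) = 1 / 2 * \<Lambda>"
      unfolding \<Lambda>_eq[symmetric] by simp
    ultimately show ?thesis
      using i(1) by auto
  qed
  moreover have "collection ?E"
    by (auto simp: collection_def sunflower_def sunflower_set_lmeasurable)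
  moreover have "carleson_norm ?E \<le> \<Lambda>"
    using carleson_norm_sunflower_le[OF \<epsilon>] \<Lambda>_eq by simp
  ultimately show "\<exists>E. collection E \<and> carleson_norm E \<le> \<Lambda> \<and>
      (\<forall>P. E = (\<Sum>i\<in>{1..N}. P i) \<longrightarrow> (\<exists>i\<in>{1..N}. 1 / 2 * \<Lambda> \<le> carleson_norm (P i)))"
    by blast
qed simp

end
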